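(* Let $A\in\mathbb{R}^{n\times n}$ be invertible, let $X_0=\alpha A^T$ with $0<\alpha<2/\|A\|_2^2$, and let $(X_k)_{k\ge0}$, $(F_k)_{k\ge 0}$, $(\beta_k)_{k\ge 0}$ be generated by the SSHP2 method. Suppose that $\lim_{k\to\infty}F_k\neq0$ (that is, $(F_k)$ does not converge to the zero matrix) and that there exist a non-negative integer $l$ and a positive constant $c$ such that $\beta_k>c$ for all $k\ge l$. Then for every $\epsilon>0$ there exist $k_0\in\mathbb{N}_0$, a positive integer $m$ and perturbation matrices $\Delta_1,\dots,\Delta_m\in\mathbb{R}^{n\times n}$ with $\|\Delta_i\|_F<\epsilon$ for $i=1,\dots,m$, such that the perturbation of $(X_k)$ using $\Delta_1,\dots,\Delta_m$ starting from the index $k_0$ satisfies $\tilde F_{k_0+m+1}=0$.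
   Context: $\mathbb{N}_0=\{0,1,2,\dots\}$; $\|\cdot\|_2$ is the spectral norm, $\|\cdot\|_F$ the Frobenius norm. Coefficient rule: for a matrix $F\in\mathbb{R}^{n\times n}$ put $B_0=\mathrm{tr}(I-F)$, $B_1=\mathrm{tr}(I-F^2)$, $C_{00}=\|I-F\|_F^2$, $C_{11}=\|I-F^2\|_F^2$, $C_{01}=\mathrm{tr}((I-F)^T(I-F^2))$ and $D=C_{00}C_{11}-C_{01}^2$. The coefficients associated with $F$ are $$\Big(\frac{C_{11}B_0-C_{01}B_1}{D},\ \frac{C_{00}B_1-C_{01}B_0}{D}\Big)\ \text{ if } D\neq0,\qquad (0,1)\ \text{ if } D=0.$$ SSHP2 method: for $k\in\mathbb{N}_0$, $F_k=I-AX_k$, $(\alpha_k,\beta_k)$ are the coefficients associated with $F_k$, and $X_{k+1}=X_k((\alpha_k+\beta_k)I+\beta_kF_k)$. The method is run without a stopping criterion. Perturbation of $(X_k)$ using $\Delta_1,\dots,\Delta_m$ starting from the index $k_0$: the sequence $(\tilde X_k)_{k\ge 0}$ defined by - $\tilde X_k=X_k$ for $k\in\{0,1,\dots,k_0+1\}$; - for $k\in\{k_0+1,\dots,k_0+m\}$: $\tilde X_{k,p}=\tilde X_k+\Delta_{k-k_0}$, $\tilde F_k=I-A\tilde X_{k,p}$, $\tilde X_{k+1}=\tilde X_{k,p}((\tilde\alpha_k+\tilde\beta_k)I+\tilde\beta_k\tilde F_k)$; - for $k>k_0+m$: $\tilde F_k=I-A\tilde X_k$, $\tilde X_{k+1}=\tilde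 X_k((\tilde\alpha_k+\tilde\beta_k)I+\tilde\beta_k\tilde F_k)$; where $(\tilde\alpha_k,\tilde\beta_k)$ are the coefficients associated with $\tilde F_k$. *)

theory Defs
  imports "HOL-Analysis.Analysis"
begin

text \<open>
  Square matrices are \<open>real^'n^'n\<close>, with product \<open>**\<close> and identity \<open>mat 1\<close>.
  The norm of this type is the Frobenius norm (lemma \<open>norm_matrix_eq_frobenius\<close>);
  the spectral norm of \<open>A\<close> is the Euclidean operator norm \<open>onorm ((*v) A)\<close>.
\<close>

lemma norm_matrix_eq_frobenius:
  fixes M :: "real^'n^'m"
  shows "norm M = sqrt (\<Sum>i\<in>UNIV. \<Sum>j\<in>UNIV. (M $ i $ j)\<^sup>2)"
  by (simp add: norm_vec_def L2_set_def sum_nonneg)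

definition sshp2_coeffs :: "real^'n^'n \<Rightarrow> real \<times> real" where
  "sshp2_coeffs F =
    (let R0 = mat 1 - F;
         R1 = mat 1 - F ** F;
         B0 = trace R0;
         B1 = trace R1;
         C00 = (norm R0)\<^sup>2;
         C11 = (norm R1)\<^sup>2;
         C01 = trace (transpose R0 ** R1);
         D = C00 * C11 - C01\<^sup>2
     in if D \<noteq> 0 then ((C11 * B0 - C01 * B1) / D, (C00 * B1 - C01 * B0) / D) else (0, 1))"

definition residual :: "real^'n^'n \<Rightarrow> real^'n^'n \<Rightarrow> real^'n^'n" where
  "residual A X = mat 1 - A ** X"

definition sshp2_step :: "real^'n^'n \<Rightarrow> real^'n^'n \<Rightarrow> real^'n^'n" where
  "sshp2_step A X =
    (let F = residual A X; (a, b) = sshp2_coeffs F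
     in X ** ((a + b) *\<^sub>R mat 1 + b *\<^sub>R F))"

primrec sshp2 :: "real^'n^'n \<Rightarrow> real^'n^'n \<Rightarrow> nat \<Rightarrow> real^'n^'n" where
  "sshp2 A X0 0 = X0"
| "sshp2 A X0 (Suc k) = sshp2_step A (sshp2 A X0 k)"

definition sshp2_F :: "real^'n^'n \<Rightarrow> real^'n^'n \<Rightarrow> nat \<Rightarrow> real^'n^'n" where
  "sshp2_F A X0 k = residual A (sshp2 A X0 k)"

definition sshp2_beta :: "real^'n^'n \<Rightarrow> real^'n^'n \<Rightarrow> nat \<Rightarrow> real" where
  "sshp2_beta A X0 k = snd (sshp2_coeffs (sshp2_F A X0 k))"

text \<open>
  The matrix to which the step at index \<open>k\<close> is applied: the perturbed iterate for
  \<open>k \<in> {k0 + 1..k0 + m}\<close>, and the iterate itself otherwise. Only the values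
  \<open>\<Delta> 1, \<dots>, \<Delta> m\<close> of \<open>\<Delta>\<close> are used.
\<close>

definition perturb_at ::
  "nat \<Rightarrow> nat \<Rightarrow> (nat \<Rightarrow> real^'n^'n) \<Rightarrow> nat \<Rightarrow> real^'n^'n \<Rightarrow> real^'n^'n" where
  "perturb_at k0 m \<Delta> k Y = (if k \<in> {k0 + 1..k0 + m} then Y + \<Delta> (k - k0) else Y)"

primrec perturbed ::
  "real^'n^'n \<Rightarrow> (nat \<Rightarrow> real^'n^'n) \<Rightarrow> nat \<Rightarrow> nat \<Rightarrow> (nat \<Rightarrow> real^'n^'n) \<Rightarrow> nat \<Rightarrow> real^'n^'n"
where
  "perturbed A X k0 m \<Delta> 0 = X 0"
| "perturbed A X k0 m \<Delta> (Suc k) =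
    (if Suc k \<le> k0 + 1 then X (Suc k)
     else sshp2_step A (perturb_at k0 m \<Delta> k (perturbed A X k0 m \<Delta> k)))"

definition perturbed_F ::
  "real^'n^'n \<Rightarrow> (nat \<Rightarrow> real^'n^'n) \<Rightarrow> nat \<Rightarrow> nat \<Rightarrow> (nat \<Rightarrow> real^'n^'n) \<Rightarrow> nat \<Rightarrow> real^'n^'n"
where
  "perturbed_F A X k0 m \<Delta> k = residual A (perturb_at k0 m \<Delta> k (perturbed A X k0 m \<Delta> k))"

end

theory Submission
  imports Defs
begin

text \<open>
  With \<open>R\<^sub>0 = I - F\<close> and \<open>R\<^sub>1 = I - F\<^sup>2\<close>, the new residual is \<open>I - a R\<^sub>0 - b R\<^sub>1\<close>, and the
  coefficient rule makes it the Frobenius least squares residual whenever the Gram determinant of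
  \<open>R\<^sub>0, R\<^sub>1\<close> is nonzero. Hence one step gives exactly \<open>0\<close> if \<open>F\<close> is not scalar and has a
  quadratic annihilating polynomial that does not vanish at \<open>1\<close>.

  A symmetric nonscalar \<open>L\<close> with vanishing Gram determinant satisfies \<open>(L - I)(L - \<gamma> I) = 0\<close> with
  \<open>\<gamma> \<noteq> 1\<close>; moving its eigenvalue \<open>1\<close> slightly yields a matrix of the previous kind. So it
  suffices that \<open>(F\<^sub>k)\<close> comes arbitrarily close to such an \<open>L\<close>, and then a single perturbation
  (\<open>m = 1\<close>) is enough. If the Gram determinant vanishes at some \<open>F\<^sub>k\<close>, take \<open>L\<close> among the
  iterates. Otherwise \<open>\<parallel>F\<^sub>k\<parallel>\<close> decreases and, by Pythagoras, \<open>F\<^sub>k - F\<^sub>k\<^sub>+\<^sub>1 \<longlonglongrightarrow> 0\<close>; dividing by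
  \<open>\<beta>\<^sub>k > c\<close> shows that the Gram determinant tends to \<open>0\<close>, so \<open>L\<close> can be any limit point.
  Such an \<open>L\<close> satisfies \<open>L \<bullet> (I - L) = 0\<close>, which leaves \<open>0\<close> and \<open>I\<close> as its only scalar values.
  They are excluded since \<open>F\<^sub>k\<close> does not tend to \<open>0\<close> and \<open>\<parallel>F\<^sub>0\<parallel> < \<parallel>I\<parallel>\<close>.
\<close>

section \<open>The Frobenius inner product and matrix multiplication\<close>

lemma trace_transpose_mult_eq_inner:
  fixes M N :: "real^'n^'m"
  shows "trace (transpose M ** N) = M \<bullet> N"
proof -
  have "trace (transpose M ** N) = (\<Sum>i\<in>UNIV. \<Sum>k\<in>UNIV. M $ k $ i * N $ k $ i)"
    by (simp add: trace_def matrix_matrix_mult_def transpose_def)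
  also have "\<dots> = M \<bullet> N"
    unfolding inner_vec_def by (subst sum.swap) simp
  finally show ?thesis .
qed

lemma inner_mat_1: "M \<bullet> mat 1 = trace (M :: real^'n^'n)"
proof -
  have "M \<bullet> mat 1 = trace (transpose (mat 1) ** M)"
    unfolding trace_transpose_mult_eq_inner by (rule inner_commute)
  then show ?thesis by simp
qed

lemma norm_mat_1_squared: "(norm (mat 1 :: real^'n^'n))\<^sup>2 = real CARD('n)"
  unfolding power2_norm_eq_inner inner_mat_1 by (simp add: trace_I)

lemma bounded_bilinear_matrix_mult:
  "bounded_bilinear ((**) :: real^'n^'n \<Rightarrow> real^'n^'n \<Rightarrow> real^'n^'n)"
  by (auto simp: bilinear_conv_bounded_bilinear[symmetric] bilinear_def linear_iff vec_eq_iff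
      matrix_matrix_mult_def sum_distrib_left sum.distrib algebra_simps)

interpretation matrix_mult: bounded_bilinear "(**) :: real^'n^'n \<Rightarrow> real^'n^'n \<Rightarrow> real^'n^'n"
  by (rule bounded_bilinear_matrix_mult)

lemmas matrix_mult_simps =
  matrix_mult.add_left matrix_mult.add_right matrix_mult.diff_left matrix_mult.diff_right
  matrix_mult.scaleR_left matrix_mult.scaleR_right

text \<open>The squared Frobenius norm is the sum of the squared column norms, and \<open>M\<close>
  acts on each column of \<open>N\<close> as on a vector.\<close>

lemma norm_matrix_mult_le_onorm:
  fixes M N :: "real^'n^'n"
  shows "norm (M ** N) \<le> onorm ((*v) M) * norm N"
proof -
  have col: "norm (column j (M ** N)) \<le> onorm ((*v) M) * norm (column j N)" for j
  proof -
    have "column j (M ** N) = M *v column j N"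
      by (simp add: vec_eq_iff column_def matrix_matrix_mult_def matrix_vector_mult_def)
    then show ?thesis by (simp add: onorm matrix_vector_mul_bounded_linear)
  qed
  have sq: "(norm K)\<^sup>2 = (\<Sum>j\<in>UNIV. (norm (column j K))\<^sup>2)" for K :: "real^'n^'n"
    unfolding power2_norm_eq_inner inner_vec_def column_def by (subst sum.swap) simp
  have "(norm (M ** N))\<^sup>2 \<le> (\<Sum>j\<in>UNIV. (onorm ((*v) M) * norm (column j N))\<^sup>2)"
    unfolding sq by (intro sum_mono power_mono col) simp
  also have "\<dots> = (onorm ((*v) M) * norm N)\<^sup>2"
    by (simp add: power_mult_distrib sq sum_distrib_left)
  finally show ?thesis
    by (rule power2_le_imp_le) (simp add: onorm_pos_le matrix_vector_mul_bounded_linear)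
qed

lemma transpose_diff: "transpose (M - N) = transpose M - transpose (N :: real^'n^'m)"
  by (simp add: transpose_def vec_eq_iff)

lemma norm_transpose: "norm (transpose M) = norm (M :: real^'n^'n)"
  unfolding norm_matrix_eq_frobenius by (subst sum.swap) (simp add: transpose_def)

section \<open>Least squares and Gram determinants for two vectors\<close>

text \<open>\<open>a\<close> and \<open>b\<close> are Cramer's rule for the 2x2 Gram system, so
  \<open>a *\<^sub>R u + b *\<^sub>R v\<close> is the orthogonal projection of \<open>w\<close> onto
  the span of \<open>u\<close> and \<open>v\<close>.\<close>

lemma normal_equations:
  fixes u v w :: "'a::real_inner"
  assumes D: "D = (norm u)\<^sup>2 * (norm v)\<^sup>2 - (u \<bullet> v)\<^sup>2" "D \<noteq> 0"
    and a: "a = ((norm v)\<^sup>2 * (u \<bullet> w) - (u \<bullet> v) * (v \<bullet> w)) / D"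
    and b: "b = ((norm u)\<^sup>2 * (v \<bullet> w) - (u \<bullet> v) * (u \<bullet> w)) / D"
  shows "(w - a *\<^sub>R u - b *\<^sub>R v) \<bullet> u = 0" "(w - a *\<^sub>R u - b *\<^sub>R v) \<bullet> v = 0"
proof -
  have aD: "a * D = (v \<bullet> v) * (u \<bullet> w) - (u \<bullet> v) * (v \<bullet> w)"
    and bD: "b * D = (u \<bullet> u) * (v \<bullet> w) - (u \<bullet> v) * (u \<bullet> w)"
    using a b D(2) by (simp_all add: power2_norm_eq_inner)
  have Dd: "D = (u \<bullet> u) * (v \<bullet> v) - (u \<bullet> v) * (u \<bullet> v)"
    using D(1) unfolding power2_norm_eq_inner by (simp add: power2_eq_square)
  have "D * ((w - a *\<^sub>R u - b *\<^sub>R v) \<bullet> u) = D * (u \<bullet> w) - (a * D) * (u \<bullet> u) - (b * D) * (u \<bullet> v)"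
    by (simp add: inner_diff_left inner_commute algebra_simps)
  also have "\<dots> = 0" unfolding aD bD unfolding Dd by (simp add: algebra_simps)
  finally show "(w - a *\<^sub>R u - b *\<^sub>R v) \<bullet> u = 0" using D(2) by simp
  have "D * ((w - a *\<^sub>R u - b *\<^sub>R v) \<bullet> v) = D * (v \<bullet> w) - (a * D) * (u \<bullet> v) - (b * D) * (v \<bullet> v)"
    by (simp add: inner_diff_left inner_commute algebra_simps)
  also have "\<dots> = 0" unfolding aD bD unfolding Dd by (simp add: algebra_simps)
  finally show "(w - a *\<^sub>R u - b *\<^sub>R v) \<bullet> v = 0" using D(2) by simp
qed

text \<open>The two sides differ by a perfect square. Since \<open>g\<close> is arbitrary, any
  approximation of \<open>v\<close> by a multiple of \<open>u\<close> bounds the Gram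
  determinant.\<close>

lemma gram_le:
  fixes u v :: "'a::real_inner"
  shows "(norm u)\<^sup>2 * (norm v)\<^sup>2 - (u \<bullet> v)\<^sup>2 \<le> (norm u)\<^sup>2 * (norm (v - g *\<^sub>R u))\<^sup>2"
proof -
  have "(norm u)\<^sup>2 * (norm (v - g *\<^sub>R u))\<^sup>2 - ((norm u)\<^sup>2 * (norm v)\<^sup>2 - (u \<bullet> v)\<^sup>2)
      = (u \<bullet> v - g * (u \<bullet> u))\<^sup>2"
    unfolding power2_norm_eq_inner
    by (simp add: inner_diff_left inner_diff_right inner_commute power2_eq_square algebra_simps)
  then show ?thesis by (metis zero_le_power2 diff_ge_0_iff_ge)
qed

lemma gram_nonneg: "(u \<bullet> v)\<^sup>2 \<le> (norm u)\<^sup>2 * (norm v)\<^sup>2" for u v :: "'a::real_inner"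
  unfolding power2_norm_eq_inner by (rule Cauchy_Schwarz_ineq)

text \<open>The equality case of Cauchy-Schwarz: \<open>g\<close> is the projection coefficient of
  \<open>v\<close> on \<open>u\<close>, and the remainder has norm 0.\<close>

lemma gram_zero_imp_scaleR:
  fixes u v :: "'a::real_inner"
  assumes "(norm u)\<^sup>2 * (norm v)\<^sup>2 - (u \<bullet> v)\<^sup>2 = 0" "u \<noteq> 0"
  obtains g where "v = g *\<^sub>R u"
proof
  define g where "g = (u \<bullet> v) / (u \<bullet> u)"
  have g: "g * (u \<bullet> u) = u \<bullet> v" using assms(2) by (simp add: g_def)
  have "(u \<bullet> u) * ((v - g *\<^sub>R u) \<bullet> (v - g *\<^sub>R u))
      = (u \<bullet> u) * (v \<bullet> v) - 2 * (g * (u \<bullet> u)) * (u \<bullet> v) + (g * (u \<bullet> u))\<^sup>2"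
    by (simp add: inner_diff_left inner_diff_right inner_commute power2_eq_square algebra_simps)
  also have "\<dots> = 0"
    unfolding g using assms(1) unfolding power2_norm_eq_inner by (simp add: power2_eq_square)
  finally show "v = g *\<^sub>R u" using assms(2) by simp
qed

section \<open>One step of the method as a map on residuals\<close>

definition sshp2_map :: "real^'n^'n \<Rightarrow> real^'n^'n" where
  "sshp2_map F = mat 1 - fst (sshp2_coeffs F) *\<^sub>R (mat 1 - F)
                       - snd (sshp2_coeffs F) *\<^sub>R (mat 1 - F ** F)"

text \<open>The number \<open>D\<close> of \<open>sshp2_coeffs\<close>, with the trace in
  \<open>C01\<close> read as an inner product.\<close>

definition sshp2_gram :: "real^'n^'n \<Rightarrow> real" where
  "sshp2_gram F = (norm (mat 1 - F))\<^sup>2 * (norm (mat 1 - F ** F))\<^sup>2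
                    - ((mat 1 - F) \<bullet> (mat 1 - F ** F))\<^sup>2"

text \<open>Since \<open>A ** X = mat 1 - F\<close>, the new residual depends on \<open>F\<close>
  alone. The sequence of residuals can thus be studied without \<open>A\<close>.\<close>

lemma residual_step: "residual A (sshp2_step A X) = sshp2_map (residual A X)"
proof -
  obtain a b where ab: "sshp2_coeffs (residual A X) = (a, b)" by fastforce
  define F where "F = residual A X"
  have AX: "A ** X = mat 1 - F" by (simp add: F_def residual_def)
  have "A ** sshp2_step A X = (mat 1 - F) ** ((a + b) *\<^sub>R mat 1 + b *\<^sub>R F)"
    using ab by (simp add: sshp2_step_def matrix_mul_assoc AX flip: F_def)
  also have "\<dots> = a *\<^sub>R (mat 1 - F) + b *\<^sub>R (mat 1 - F ** F)"
    by (simp add: matrix_mult_simps algebra_simps)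
  finally have "residual A (sshp2_step A X)
      = mat 1 - a *\<^sub>R (mat 1 - F) - b *\<^sub>R (mat 1 - F ** F)"
    unfolding residual_def by (simp add: algebra_simps)
  then show ?thesis using ab by (simp add: sshp2_map_def F_def)
qed

lemma sshp2_F_Suc: "sshp2_F A X0 (Suc k) = sshp2_map (sshp2_F A X0 k)"
  by (simp add: sshp2_F_def residual_step)

lemma sshp2_map_orthogonal:
  assumes "sshp2_gram F \<noteq> 0"
  shows "sshp2_map F \<bullet> (mat 1 - F) = 0" "sshp2_map F \<bullet> (mat 1 - F ** F) = 0"
proof -
  let ?u = "mat 1 - F" and ?v = "mat 1 - F ** F"
  have "fst (sshp2_coeffs F)
      = ((norm ?v)\<^sup>2 * (?u \<bullet> mat 1) - (?u \<bullet> ?v) * (?v \<bullet> mat 1)) / sshp2_gram F"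
    "snd (sshp2_coeffs F)
      = ((norm ?u)\<^sup>2 * (?v \<bullet> mat 1) - (?u \<bullet> ?v) * (?u \<bullet> mat 1)) / sshp2_gram F"
    using assms unfolding sshp2_coeffs_def Let_def trace_transpose_mult_eq_inner inner_mat_1
      sshp2_gram_def by simp_all
  from normal_equations[OF sshp2_gram_def assms this]
  show "sshp2_map F \<bullet> ?u = 0" "sshp2_map F \<bullet> ?v = 0"
    unfolding sshp2_map_def by simp_all
qed

lemma sshp2_map_gram_zero:
  assumes "sshp2_gram F = 0"
  shows "sshp2_map F = F ** F"
proof -
  have "sshp2_coeffs F = (0, 1)"
    using assms unfolding sshp2_coeffs_def Let_def trace_transpose_mult_eq_inner sshp2_gram_def
    by simp
  then show ?thesis by (simp add: sshp2_map_def)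
qed

text \<open>\<open>F\<close> is itself a competitor in the least squares problem, with coefficients
  \<open>(1, 0)\<close>. Hence \<open>F - sshp2_map F\<close> lies in the span to which
  \<open>sshp2_map F\<close> is orthogonal.\<close>

lemma norm_sshp2_map:
  assumes "sshp2_gram F \<noteq> 0"
  shows "(norm F)\<^sup>2 = (norm (sshp2_map F))\<^sup>2 + (norm (F - sshp2_map F))\<^sup>2"
proof -
  obtain a b where "sshp2_map F = mat 1 - a *\<^sub>R (mat 1 - F) - b *\<^sub>R (mat 1 - F ** F)"
    by (auto simp: sshp2_map_def)
  then have "F - sshp2_map F = (a - 1) *\<^sub>R (mat 1 - F) + b *\<^sub>R (mat 1 - F ** F)"
    by (simp add: algebra_simps)
  then have "sshp2_map F \<bullet> (F - sshp2_map F) = 0"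
    using sshp2_map_orthogonal[OF assms] by (simp only: inner_add_right inner_scaleR_right mult_zero_right add_0_right)
  then show ?thesis
    using norm_add_Pythagorean[of "sshp2_map F" "F - sshp2_map F"] by (simp add: orthogonal_def)
qed

lemma transpose_sshp2_map:
  assumes "transpose F = F"
  shows "transpose (sshp2_map F) = sshp2_map F"
  by (simp add: sshp2_map_def transpose_diff transpose_scalar matrix_transpose_mul assms)

section \<open>Residuals that one step sends to zero\<close>

text \<open>As \<open>p + q \<noteq> 1\<close>, the identity lies in the span of
  \<open>mat 1 - G\<close> and \<open>mat 1 - G ** G\<close>, so its least squares residual is 0. A
  vanishing Gram determinant would force \<open>G\<close> to be scalar.\<close>

lemma sshp2_map_eq_0:
  fixes G :: "real^'n^'n"
  assumes quad: "G ** G = p *\<^sub>R G + q *\<^sub>R mat 1" and pq: "p + q \<noteq> 1"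
    and nonscalar: "\<And>\<mu>. G \<noteq> \<mu> *\<^sub>R mat 1"
  shows "sshp2_map G = 0"
proof -
  have R1: "mat 1 - G ** G = p *\<^sub>R (mat 1 - G) + (1 - p - q) *\<^sub>R mat 1"
    unfolding quad by (simp add: algebra_simps)
  have gram: "sshp2_gram G \<noteq> 0"
  proof
    assume "sshp2_gram G = 0"
    moreover have "mat 1 - G \<noteq> 0" using nonscalar[of 1] by auto
    ultimately obtain g where "mat 1 - G ** G = g *\<^sub>R (mat 1 - G)"
      unfolding sshp2_gram_def by (rule gram_zero_imp_scaleR)
    then have eq: "(1 - p - q) *\<^sub>R mat 1 = (g - p) *\<^sub>R (mat 1 - G)"
      unfolding R1 by (simp add: algebra_simps)
    have "g \<noteq> p"
    proof
      assume "g = p"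
      with eq pq have "norm (mat 1 :: real^'n^'n) = 0" by simp
      with norm_mat_1_squared[where 'n = 'n] show False by simp
    qed
    have "G = (1 - (1 - p - q) / (g - p)) *\<^sub>R mat 1"
    proof -
      have "mat 1 - G = inverse (g - p) *\<^sub>R ((g - p) *\<^sub>R (mat 1 - G))"
        using \<open>g \<noteq> p\<close> by simp
      also have "\<dots> = ((1 - p - q) / (g - p)) *\<^sub>R mat 1"
        unfolding eq[symmetric] by (simp add: divide_inverse mult.commute)
      finally show ?thesis by (simp add: algebra_simps)
    qed
    with nonscalar show False by blast
  qed
  note orth = sshp2_map_orthogonal[OF gram]
  have "(1 - p - q) * (sshp2_map G \<bullet> mat 1) = 0"
    using orth unfolding R1 by (simp add: inner_add_right)
  then have "sshp2_map G \<bullet> mat 1 = 0" using pq by simp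
  then have "sshp2_map G \<bullet> sshp2_map G = 0"
    using orth by (subst (2) sshp2_map_def) (simp add: inner_diff_right)
  then show ?thesis by simp
qed

lemma sshp2_map_zero_nearby:
  fixes L :: "real^'n^'n"
  assumes sym: "transpose L = L" and gram: "sshp2_gram L = 0"
    and nonscalar: "\<And>\<mu>. L \<noteq> \<mu> *\<^sub>R mat 1" and e: "e > 0"
  obtains G where "norm (L - G) < e" "sshp2_map G = 0"
proof -
  have "mat 1 - L \<noteq> 0" using nonscalar[of 1] by auto
  then obtain g where "mat 1 - L ** L = g *\<^sub>R (mat 1 - L)"
    using gram unfolding sshp2_gram_def by (elim gram_zero_imp_scaleR)
  then have L2: "L ** L = g *\<^sub>R L + (1 - g) *\<^sub>R mat 1"
    by (simp add: algebra_simps)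
  \<comment> \<open>For \<open>g = 2\<close> the two roots 1 and \<open>g - 1\<close> coincide and
    \<open>mat 1 - L\<close> squares to 0, which is impossible for a nonzero symmetric
    matrix.\<close>
  have "g \<noteq> 2"
  proof
    assume "g = 2"
    have "transpose (mat 1 - L) = mat 1 - L"
      using sym by (simp add: transpose_def vec_eq_iff mat_def)
    then have "(mat 1 - L) \<bullet> (mat 1 - L) = trace ((mat 1 - L) ** (mat 1 - L))"
      by (metis trace_transpose_mult_eq_inner)
    also have "(mat 1 - L) ** (mat 1 - L) = 0"
      using \<open>g = 2\<close> by (simp add: matrix_mult_simps L2 scaleR_2)
    finally show False using \<open>mat 1 - L \<noteq> 0\<close> by (simp add: trace_def)
  qed
  define N where "N = norm (L - (g - 1) *\<^sub>R mat 1)"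
  have "N > 0" using nonscalar by (simp add: N_def)
  \<comment> \<open>The distance from \<open>L\<close> to \<open>G\<close> will be
    \<open>t * N\<close>. The bound 1/2 keeps \<open>t < 1\<close>, so that a scalar
    \<open>G\<close> would make \<open>L\<close> scalar.\<close>
  define t where "t = min (1/2) (e / (2 * N))"
  have t: "t > 0" "t < 1" and tN: "t * N < e"
  proof -
    show "t > 0" "t < 1" using e \<open>N > 0\<close> by (auto simp: t_def)
    have "t * N \<le> e / (2 * N) * N" using \<open>N > 0\<close> by (intro mult_right_mono) (auto simp: t_def)
    also have "\<dots> < e" using \<open>N > 0\<close> e by simp
    finally show "t * N < e" .
  qed
  \<comment> \<open>\<open>G\<close> keeps the eigenvalue \<open>g - 1\<close> of \<open>L\<close> and replaces the eigenvalue \<open>1\<close> by \<open>1 - s\<close>.\<close>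
  define G where "G = (1 - t) *\<^sub>R L + (t * (g - 1)) *\<^sub>R mat 1"
  define s where "s = t * (2 - g)"
  show thesis
  proof
    have "L - G = t *\<^sub>R (L - (g - 1) *\<^sub>R mat 1)"
      by (simp add: G_def algebra_simps)
    then show "norm (L - G) < e" using t(1) tN by (simp add: N_def)
    show "sshp2_map G = 0"
    proof (rule sshp2_map_eq_0)
      have "G ** G = ((1 - t)\<^sup>2) *\<^sub>R (L ** L) + (2 * (1 - t) * (t * (g - 1))) *\<^sub>R L
          + ((t * (g - 1))\<^sup>2) *\<^sub>R mat 1"
        unfolding G_def matrix_mult_simps by (simp add: vec_eq_iff power2_eq_square algebra_simps)
      then show "G ** G = (g - s) *\<^sub>R G + (- (g - 1) * (1 - s)) *\<^sub>R mat 1"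
        unfolding L2 G_def s_def
        by (simp add: vec_eq_iff power2_eq_square algebra_simps)
      \<comment> \<open>This is the value at 1 of the monic quadratic with roots
        \<open>g - 1\<close> and \<open>1 - s\<close>.\<close>
      have "1 - ((g - s) + - (g - 1) * (1 - s)) = t * (2 - g)\<^sup>2"
        by (simp add: s_def power2_eq_square algebra_simps)
      then show "(g - s) + - (g - 1) * (1 - s) \<noteq> 1"
        using t(1) \<open>g \<noteq> 2\<close> by auto
      fix \<mu>
      show "G \<noteq> \<mu> *\<^sub>R mat 1"
      proof
        assume "G = \<mu> *\<^sub>R mat 1"
        then have "(1 - t) *\<^sub>R L = (\<mu> - t * (g - 1)) *\<^sub>R mat 1"
          by (simp add: G_def algebra_simps)
        then have "inverse (1 - t) *\<^sub>R ((1 - t) *\<^sub>R L)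
            = (inverse (1 - t) * (\<mu> - t * (g - 1))) *\<^sub>R mat 1"
          by simp
        then have "L = (inverse (1 - t) * (\<mu> - t * (g - 1))) *\<^sub>R mat 1"
          using t(2) by simp
        with nonscalar show False by blast
      qed
    qed
  qed
qed

section \<open>Scalar residuals and the initial residual\<close>

lemma sshp2_gram_scalar: "sshp2_gram (\<mu> *\<^sub>R mat 1) = 0"
proof -
  have *: "mat 1 - \<mu> *\<^sub>R mat 1 = (1 - \<mu>) *\<^sub>R (mat 1 :: real^'n^'n)"
    "mat 1 - (\<mu> *\<^sub>R mat 1) ** (\<mu> *\<^sub>R mat 1) = (1 - \<mu>\<^sup>2) *\<^sub>R (mat 1 :: real^'n^'n)"
    by (simp_all add: algebra_simps power2_eq_square matrix_mult_simps)
  show ?thesis unfolding sshp2_gram_def * power2_norm_eq_inner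
    by (simp add: power2_eq_square)
qed

lemma sshp2_map_scalar: "sshp2_map (\<mu> *\<^sub>R mat 1) = \<mu>\<^sup>2 *\<^sub>R mat 1"
  by (simp add: sshp2_map_gram_zero sshp2_gram_scalar matrix_mult_simps
      power2_eq_square)

text \<open>In the expanded square the linear term is
  \<open>- 2 * \<alpha> * (norm A)\<^sup>2\<close>, because the trace of
  \<open>A ** transpose A\<close> is \<open>(norm A)\<^sup>2\<close>. The bound on \<alpha> makes it
  outweigh the quadratic term.\<close>

lemma residual_initial_norm:
  fixes A :: "real^'n^'n"
  assumes "invertible A" "0 < \<alpha>" "\<alpha> < 2 / (onorm ((*v) A))\<^sup>2"
  shows "norm (residual A (\<alpha> *\<^sub>R transpose A)) < norm (mat 1 :: real^'n^'n)"
proof -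
  define \<sigma> where "\<sigma> = onorm ((*v) A)"
  \<comment> \<open>If \<sigma> were 0, then \<open>2 / \<sigma>\<^sup>2\<close> would be 0 by
    convention, against \<open>0 < \<alpha>\<close>.\<close>
  have "\<sigma> \<noteq> 0" using assms(2,3) by (auto simp: \<sigma>_def)
  then have \<alpha>: "\<alpha> * \<sigma>\<^sup>2 < 2"
    using assms(3) by (simp add: \<sigma>_def field_simps)
  have "A \<noteq> 0"
  proof
    assume "A = 0"
    then have "(mat 1 :: real^'n^'n) = 0"
      using assms(1) by (auto simp: invertible_def matrix_mult.zero_left)
    then have "norm (mat 1 :: real^'n^'n) = 0" by simp
    with norm_mat_1_squared[where 'n = 'n] show False by simp
  qed
  have tr: "mat 1 \<bullet> (A ** transpose A) = (norm A)\<^sup>2"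
    using trace_transpose_mult_eq_inner[of "transpose A" "transpose A"]
    by (simp add: inner_commute[of "mat 1"] inner_mat_1 norm_transpose flip: power2_norm_eq_inner)
  have "norm (A ** transpose A) \<le> \<sigma> * norm A"
    using norm_matrix_mult_le_onorm[of A "transpose A"] by (simp add: \<sigma>_def norm_transpose)
  then have sq: "(norm (A ** transpose A))\<^sup>2 \<le> \<sigma>\<^sup>2 * (norm A)\<^sup>2"
    by (metis norm_ge_zero power_mono power_mult_distrib)
  have "(norm (residual A (\<alpha> *\<^sub>R transpose A)))\<^sup>2
      = (norm (mat 1 :: real^'n^'n))\<^sup>2 - 2 * \<alpha> * (norm A)\<^sup>2 + \<alpha>\<^sup>2 * (norm (A ** transpose A))\<^sup>2"
    unfolding tr[symmetric] unfolding power2_norm_eq_inner residual_def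
    by (simp add: matrix_mult_simps inner_diff_left inner_diff_right inner_commute power2_eq_square
        algebra_simps)
  also have "\<dots> \<le> (norm (mat 1 :: real^'n^'n))\<^sup>2 - 2 * \<alpha> * (norm A)\<^sup>2 + \<alpha>\<^sup>2 * (\<sigma>\<^sup>2 * (norm A)\<^sup>2)"
    using sq by (simp add: mult_left_mono)
  also have "\<dots> = (norm (mat 1 :: real^'n^'n))\<^sup>2 - \<alpha> * (norm A)\<^sup>2 * (2 - \<alpha> * \<sigma>\<^sup>2)"
    by (simp add: power2_eq_square algebra_simps)
  also have "\<dots> < (norm (mat 1 :: real^'n^'n))\<^sup>2"
    using \<alpha> assms(2) \<open>A \<noteq> 0\<close> by simp
  finally show ?thesis by (rule power2_less_imp_less) simp
qed

text \<open>Each step squares the scalar, so the iterates follow a subsequence of the powers of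
  \<mu>.\<close>

lemma sshp2_scalar_tendsto_zero:
  fixes F :: "nat \<Rightarrow> real^'n^'n"
  assumes step: "\<And>k. F (Suc k) = sshp2_map (F k)"
    and k: "F k = \<mu> *\<^sub>R mat 1" and \<mu>: "\<bar>\<mu>\<bar> < 1"
  shows "F \<longlonglongrightarrow> 0"
proof -
  have F: "F (j + k) = (\<mu> ^ 2 ^ j) *\<^sub>R mat 1" for j
    by (induction j) (simp_all add: k step sshp2_map_scalar mult.commute flip: power_mult)
  have "strict_mono (\<lambda>j. 2 ^ j :: nat)" by (simp add: strict_mono_def)
  then have "(\<lambda>j. \<mu> ^ 2 ^ j) \<longlonglongrightarrow> 0"
    using LIMSEQ_subseq_LIMSEQ[OF LIMSEQ_power_zero[of \<mu>]] \<mu> by (simp add: comp_def)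
  then have "(\<lambda>j. F (j + k)) \<longlonglongrightarrow> 0 *\<^sub>R mat 1"
    unfolding F by (intro tendsto_intros)
  then show ?thesis by (simp add: LIMSEQ_offset)
qed

section \<open>Nonscalar residuals with vanishing Gram determinant, among the iterates or their
  limit points\<close>

lemma sshp2_gram_zero_iterate:
  fixes F :: "nat \<Rightarrow> real^'n^'n"
  assumes step: "\<And>k. F (Suc k) = sshp2_map (F k)"
    and norm0: "norm (F 0) < norm (mat 1 :: real^'n^'n)"
    and inv: "invertible (mat 1 - F 0)"
    and lim: "\<not> F \<longlonglongrightarrow> 0"
    and gram: "sshp2_gram (F k) = 0"
  obtains j where "sshp2_gram (F (Suc j)) = 0" "\<And>\<mu>. F (Suc j) \<noteq> \<mu> *\<^sub>R mat 1"
proof -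
  \<comment> \<open>Norms are controlled only while least squares steps are made, hence the first such index.\<close>
  define i where "i = (LEAST i. sshp2_gram (F i) = 0)"
  have i: "sshp2_gram (F i) = 0" unfolding i_def using gram by (rule LeastI)
  have before: "sshp2_gram (F j) \<noteq> 0" if "j < i" for j
    using that not_less_Least unfolding i_def by blast
  have "norm (F j) \<le> norm (F 0)" if "j \<le> i" for j
    using that
  proof (induction j)
    case (Suc j)
    have "(norm (F (Suc j)))\<^sup>2 \<le> (norm (F j))\<^sup>2"
      using norm_sshp2_map[OF before, of j] Suc.prems by (simp add: step)
    then show ?case using Suc by (simp add: order_trans)
  qed simp
  then have norm_i: "norm (F i) < norm (mat 1 :: real^'n^'n)"
    using norm0 le_less_trans by blast
  have nonscalar: "F i \<noteq> \<mu> *\<^sub>R mat 1" for \<mu>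
  proof
    assume \<mu>: "F i = \<mu> *\<^sub>R mat 1"
    with norm_i have "\<bar>\<mu>\<bar> * norm (mat 1 :: real^'n^'n) < 1 * norm (mat 1 :: real^'n^'n)" by simp
    then have "\<bar>\<mu>\<bar> < 1" by (rule mult_right_less_imp_less) simp
    with sshp2_scalar_tendsto_zero[of F, OF step \<mu>] lim show False by blast
  qed
  \<comment> \<open>The first iterate that may be perturbed has index \<open>1\<close>.\<close>
  have "i \<noteq> 0"
  proof
    assume "i = 0"
    have "mat 1 - F 0 \<noteq> 0" using nonscalar[of 1] \<open>i = 0\<close> by auto
    moreover have "(norm (mat 1 - F 0))\<^sup>2 * (norm (mat 1 - F 0 ** F 0))\<^sup>2
        - ((mat 1 - F 0) \<bullet> (mat 1 - F 0 ** F 0))\<^sup>2 = 0"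
      using i \<open>i = 0\<close> by (simp add: sshp2_gram_def)
    ultimately obtain g where g: "mat 1 - F 0 ** F 0 = g *\<^sub>R (mat 1 - F 0)"
      by (metis gram_zero_imp_scaleR)
    obtain N where N: "N ** (mat 1 - F 0) = mat 1"
      using inv by (auto simp: invertible_def)
    \<comment> \<open>Cancelling the invertible left factor makes \<open>F 0\<close> scalar, which
      is already excluded.\<close>
    have "(mat 1 - F 0) ** (mat 1 + F 0 - g *\<^sub>R mat 1) = 0"
      using g by (simp add: matrix_mult_simps algebra_simps)
    then have "N ** ((mat 1 - F 0) ** (mat 1 + F 0 - g *\<^sub>R mat 1)) = 0"
      by (simp add: matrix_mult.zero_right)
    then have "mat 1 + F 0 - g *\<^sub>R mat 1 = 0" by (simp add: matrix_mul_assoc N)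
    then have "F 0 = (g - 1) *\<^sub>R mat 1" by (simp add: algebra_simps)
    with nonscalar \<open>i = 0\<close> show False by blast
  qed
  then obtain j where "i = Suc j" using not0_implies_Suc by blast
  with i nonscalar that show thesis by blast
qed

lemma sshp2_gram_zero_limit_point:
  fixes F :: "nat \<Rightarrow> real^'n^'n"
  assumes step: "\<And>k. F (Suc k) = sshp2_map (F k)"
    and sym: "\<And>k. transpose (F k) = F k"
    and norm0: "norm (F 0) < norm (mat 1 :: real^'n^'n)"
    and lim: "\<not> F \<longlonglongrightarrow> 0"
    and gram: "\<And>k. sshp2_gram (F k) \<noteq> 0"
    and c: "c > 0" and beta: "\<And>k. k \<ge> l \<Longrightarrow> snd (sshp2_coeffs (F k)) > c"
  obtains L r where "strict_mono r" "(F \<circ> r) \<longlonglongrightarrow> L" "transpose L = L" "sshp2_gram L = 0"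
    "\<And>\<mu>. L \<noteq> \<mu> *\<^sub>R mat 1"
proof -
  have pyth: "(norm (F k))\<^sup>2 = (norm (F (Suc k)))\<^sup>2 + (norm (F k - F (Suc k)))\<^sup>2" for k
    using norm_sshp2_map[OF gram] by (simp add: step)
  have "(norm (F (Suc k)))\<^sup>2 \<le> (norm (F k))\<^sup>2" for k using pyth[of k] by simp
  then have "norm (F (Suc k)) \<le> norm (F k)" for k by simp
  then have dec: "decseq (\<lambda>k. norm (F k))" by (intro decseq_SucI)
  then have bound: "norm (F k) \<le> norm (F 0)" for k using decseqD[OF dec, of 0 k] by simp
  obtain \<rho> where \<rho>: "(\<lambda>k. norm (F k)) \<longlonglongrightarrow> \<rho>"
    using decseq_convergent[OF dec, of 0] by auto
  \<comment> \<open>By Pythagoras the squared increments are consecutive differences of a convergent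
    sequence.\<close>
  have "(\<lambda>k. (norm (F k))\<^sup>2 - (norm (F (Suc k)))\<^sup>2) \<longlonglongrightarrow> \<rho>\<^sup>2 - \<rho>\<^sup>2"
    by (intro tendsto_diff tendsto_power \<rho> LIMSEQ_Suc[OF \<rho>])
  moreover have "(norm (F k))\<^sup>2 - (norm (F (Suc k)))\<^sup>2 = (norm (F k - F (Suc k)))\<^sup>2" for k
    using pyth[of k] by simp
  ultimately have "(\<lambda>k. (norm (F k - F (Suc k)))\<^sup>2) \<longlonglongrightarrow> 0" by simp
  then have "(\<lambda>k. sqrt ((norm (F k - F (Suc k)))\<^sup>2)) \<longlonglongrightarrow> sqrt 0"
    by (rule tendsto_real_sqrt)
  then have diff: "(\<lambda>k. F k - F (Suc k)) \<longlonglongrightarrow> 0"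
    by (simp add: tendsto_norm_zero_iff)
  have "bounded (range F)" using bound by (auto simp: bounded_iff)
  then obtain L r where r: "strict_mono r" and L: "(F \<circ> r) \<longlonglongrightarrow> L"
    using bounded_imp_convergent_subsequence by blast
  note Lr = L[unfolded comp_def]
  have diff_r: "(\<lambda>k. F (r k) - F (Suc (r k))) \<longlonglongrightarrow> 0"
    using LIMSEQ_subseq_LIMSEQ[OF diff r] by (simp add: comp_def)
  have norm_L: "norm L = \<rho>"
    using LIMSEQ_unique[OF tendsto_norm[OF Lr]] LIMSEQ_subseq_LIMSEQ[OF \<rho> r]
    by (simp add: comp_def)
  have "\<rho> \<le> norm (F 0)" using \<rho> bound by (intro LIMSEQ_le_const2) auto
  have "L \<noteq> mat 1" using norm_L \<open>\<rho> \<le> norm (F 0)\<close> norm0 by auto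
  have "L \<noteq> 0"
  proof
    assume "L = 0"
    with \<rho> norm_L have "F \<longlonglongrightarrow> 0" by (simp add: tendsto_norm_zero_iff)
    with lim show False by blast
  qed
  have "(\<lambda>k. transpose (F (r k))) \<longlonglongrightarrow> transpose L"
    unfolding transpose_def
    by (intro tendsto_vec_lambda tendsto_vec_nth Lr)
  then have "transpose L = L"
    unfolding sym using Lr LIMSEQ_unique by blast

  have orth: "L \<bullet> (mat 1 - L) = 0"
  proof -
    \<comment> \<open>The first factor is \<open>F (Suc (r k))\<close>, written so that its limit
      \<open>L\<close> can be read off. Orthogonality of the new residual to
      \<open>mat 1 - F (r k)\<close> then passes to the limit.\<close>
    have "(\<lambda>k. (F (r k) - (F (r k) - F (Suc (r k)))) \<bullet> (mat 1 - F (r k))) \<longlonglongrightarrow> (L - 0) \<bullet> (mat 1 - L)"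
      by (intro tendsto_intros Lr diff_r)
    moreover have "(F (r k) - (F (r k) - F (Suc (r k)))) \<bullet> (mat 1 - F (r k)) = 0" for k
      using sshp2_map_orthogonal(1)[OF gram] by (simp add: step)
    ultimately show ?thesis by (simp add: LIMSEQ_const_iff)
  qed
  have nonscalar: "L \<noteq> \<mu> *\<^sub>R mat 1" for \<mu>
  proof
    assume \<mu>: "L = \<mu> *\<^sub>R mat 1"
    have "mat 1 - L = (1 - \<mu>) *\<^sub>R mat 1" unfolding \<mu> by (simp add: algebra_simps)
    with orth have "\<mu> = 0 \<or> 1 - \<mu> = 0 \<or> (norm (mat 1 :: real^'n^'n))\<^sup>2 = 0"
      unfolding \<mu> power2_norm_eq_inner by auto
    with \<open>L \<noteq> 0\<close> \<open>L \<noteq> mat 1\<close> \<mu> norm_mat_1_squared[where 'n = 'n] show False by auto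
  qed
  \<comment> \<open>The Gram determinants along \<open>r\<close> are bounded by a multiple of the
    squared increments, which tend to 0.\<close>
  have "sshp2_gram L \<le> 0"
  proof (rule LIMSEQ_le)
    show "(\<lambda>k. sshp2_gram (F (r k))) \<longlonglongrightarrow> sshp2_gram L"
      unfolding sshp2_gram_def by (intro tendsto_intros matrix_mult.tendsto Lr)
    have "(\<lambda>k. (norm (mat 1 - F (r k)))\<^sup>2 * (norm (F (r k) - F (Suc (r k))) / c)\<^sup>2)
        \<longlonglongrightarrow> (norm (mat 1 - L))\<^sup>2 * (norm (0 :: real^'n^'n) / c)\<^sup>2"
      using c by (intro tendsto_intros Lr diff_r) auto
    then show "(\<lambda>k. (norm (mat 1 - F (r k)))\<^sup>2 * (norm (F (r k) - F (Suc (r k))) / c)\<^sup>2) \<longlonglongrightarrow> 0"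
      by simp
    have "sshp2_gram (F (r k)) \<le> (norm (mat 1 - F (r k)))\<^sup>2 * (norm (F (r k) - F (Suc (r k))) / c)\<^sup>2"
      if "k \<ge> l" for k
    proof -
      define a b where "a = fst (sshp2_coeffs (F (r k)))" and "b = snd (sshp2_coeffs (F (r k)))"
      have "r k \<ge> l" using seq_suble[OF r, of k] that by simp
      then have b: "b > c" unfolding b_def by (rule beta)
      \<comment> \<open>The increment is a combination of \<open>mat 1 - F (r k)\<close> and
        \<open>mat 1 - F (r k) ** F (r k)\<close> with coefficients \<open>a - 1\<close> and
        \<open>b\<close>. Dividing by \<open>b\<close> gives the remainder \<open>R\<close> to which
        \<open>gram_le\<close> applies.\<close>
      define g where "g = (1 - a) / b"
      define R where "R = mat 1 - F (r k) ** F (r k) - g *\<^sub>R (mat 1 - F (r k))"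
      have "F (r k) - F (Suc (r k)) = b *\<^sub>R R"
      proof -
        have "b * g = 1 - a" using b c by (simp add: g_def)
        then have "b *\<^sub>R R = b *\<^sub>R (mat 1 - F (r k) ** F (r k)) - (1 - a) *\<^sub>R (mat 1 - F (r k))"
          by (simp add: R_def scaleR_diff_right[of b "mat 1 - F (r k) ** F (r k)"])
        then show ?thesis
          by (simp add: step sshp2_map_def a_def[symmetric] b_def[symmetric] scaleR_diff_left)
      qed
      then have "c * norm R \<le> norm (F (r k) - F (Suc (r k)))"
        using b c by (simp add: mult_right_mono)
      then have "norm R \<le> norm (F (r k) - F (Suc (r k))) / c"
        using c by (simp add: field_simps)
      moreover have "sshp2_gram (F (r k)) \<le> (norm (mat 1 - F (r k)))\<^sup>2 * (norm R)\<^sup>2"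
        unfolding sshp2_gram_def R_def by (rule gram_le)
      ultimately show ?thesis
        by (meson mult_left_mono norm_ge_zero order_trans power_mono zero_le_power2)
    qed
    then show "\<exists>N. \<forall>n\<ge>N. sshp2_gram (F (r n))
        \<le> (norm (mat 1 - F (r n)))\<^sup>2 * (norm (F (r n) - F (Suc (r n))) / c)\<^sup>2"
      by blast
  qed
  moreover have "sshp2_gram L \<ge> 0" unfolding sshp2_gram_def using gram_nonneg by simp
  ultimately have "sshp2_gram L = 0" by simp
  with r L \<open>transpose L = L\<close> nonscalar that show thesis by blast
qed

section \<open>From a nearby residual to a perturbation of the iterate\<close>

lemma residual_add:
  "residual A (X + Y) = residual A X - A ** Y"
  by (simp add: residual_def matrix_mult_simps)

theorem theorem3p11:
  fixes A X0 :: "real^'n^'n" and \<alpha> :: real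
  assumes "invertible A"
    and "X0 = \<alpha> *\<^sub>R transpose A"
    and "0 < \<alpha>" and "\<alpha> < 2 / (onorm ((*v) A))\<^sup>2"
    and "\<not> (sshp2_F A X0 \<longlonglongrightarrow> 0)"
    and "\<exists>l::nat. \<exists>c>0. \<forall>k\<ge>l. sshp2_beta A X0 k > c"
  shows "\<forall>\<epsilon>>0. \<exists>k0 m (\<Delta> :: nat \<Rightarrow> real^'n^'n). m > 0 \<and>
           (\<forall>i\<in>{1..m}. norm (\<Delta> i) < \<epsilon>) \<and>
           perturbed_F A (sshp2 A X0) k0 m \<Delta> (k0 + m + 1) = 0"
proof (intro allI impI)
  fix \<epsilon> :: real
  assume "\<epsilon> > 0"
  obtain A' where A': "A ** A' = mat 1" using assms(1) by (auto simp: invertible_def)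
  define F where "F = sshp2_F A X0"
  have step: "F (Suc k) = sshp2_map (F k)" for k by (simp add: F_def sshp2_F_Suc)
  have F0: "F 0 = residual A (\<alpha> *\<^sub>R transpose A)" by (simp add: F_def sshp2_F_def assms(2))
  have norm0: "norm (F 0) < norm (mat 1 :: real^'n^'n)"
    unfolding F0 using assms by (intro residual_initial_norm)
  have sym: "transpose (F k) = F k" for k
  proof (induction k)
    case 0
    have "F 0 = mat 1 - \<alpha> *\<^sub>R (A ** transpose A)"
      by (simp add: F0 residual_def matrix_mult_simps)
    moreover have "transpose (A ** transpose A) = A ** transpose A"
      by (simp add: matrix_transpose_mul)
    ultimately show ?case by (simp add: transpose_diff transpose_scalar)
  qed (simp add: step transpose_sshp2_map)
  have inv: "invertible (mat 1 - F 0)"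
  proof -
    have "mat 1 - F 0 = A ** (\<alpha> *\<^sub>R transpose A)" by (simp add: F0 residual_def)
    moreover have "invertible (\<alpha> *\<^sub>R transpose A)"
      using assms(1,3) by (simp add: scalar_invertible transpose_invertible)
    ultimately show ?thesis using assms(1) by (simp add: invertible_mult)
  qed
  have lim: "\<not> F \<longlonglongrightarrow> 0" using assms(5) by (simp add: F_def)
  obtain K where K: "K > 0" "\<And>M :: real^'n^'n. norm (A' ** M) \<le> norm M * K"
    using bounded_linear.pos_bounded[OF matrix_mult.bounded_linear_right[of A']] by auto
  \<comment> \<open>\<open>F (Suc k)\<close> is within \<eta> of \<open>L\<close> and
    \<open>L\<close> within \<eta> of \<open>G\<close>; returning to iterates through
    \<open>A'\<close> costs the factor \<open>K\<close>.\<close>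
  define \<eta> where "\<eta> = \<epsilon> / K / 2"
  have \<eta>: "\<eta> > 0" "2 * \<eta> * K = \<epsilon>" using \<open>\<epsilon> > 0\<close> K(1) by (simp_all add: \<eta>_def)

  obtain k L where kL: "norm (F (Suc k) - L) < \<eta>" "transpose L = L" "sshp2_gram L = 0"
    "\<And>\<mu>. L \<noteq> \<mu> *\<^sub>R mat 1"
  proof (cases "\<exists>k. sshp2_gram (F k) = 0")
    case True
    then obtain j where "sshp2_gram (F (Suc j)) = 0" "\<And>\<mu>. F (Suc j) \<noteq> \<mu> *\<^sub>R mat 1"
      using sshp2_gram_zero_iterate[of F, OF step norm0 inv lim] by metis
    with that[of j "F (Suc j)"] sym \<eta>(1) show thesis by simp
  next
    case False
    obtain l c where "c > 0" "\<And>k. k \<ge> l \<Longrightarrow> snd (sshp2_coeffs (F k)) > c"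
      using assms(6) by (auto simp: sshp2_beta_def F_def)
    with False obtain L r where L: "strict_mono r" "(F \<circ> r) \<longlonglongrightarrow> L" "transpose L = L"
      "sshp2_gram L = 0" "\<And>\<mu>. L \<noteq> \<mu> *\<^sub>R mat 1"
      using sshp2_gram_zero_limit_point[of F c l, OF step sym norm0 lim] by metis
    obtain N where "\<And>n. n \<ge> N \<Longrightarrow> norm (F (r n) - L) < \<eta>"
      using LIMSEQ_D[OF L(2) \<eta>(1)] by auto
    \<comment> \<open>Taking \<open>Suc N\<close> instead of \<open>N\<close> ensures that the index
      \<open>r (Suc N)\<close> is positive, as the first perturbed index \<open>k0 + 1\<close> must
      be.\<close>
    then have "norm (F (r (Suc N)) - L) < \<eta>" by simp
    moreover have "r (Suc N) = Suc (r (Suc N) - 1)" using seq_suble[OF L(1), of "Suc N"] by simp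
    ultimately show thesis using that[of "r (Suc N) - 1" L] L by metis
  qed
  obtain G where G: "norm (L - G) < \<eta>" "sshp2_map G = 0"
    using sshp2_map_zero_nearby[OF kL(2,3,4) \<eta>(1)] .
  \<comment> \<open>Adding this matrix to the iterate subtracts \<open>F (Suc k) - G\<close> from
    the residual, because \<open>A ** A' = mat 1\<close>.\<close>
  define \<Delta> where "\<Delta> = (\<lambda>_::nat. A' ** (F (Suc k) - G))"
  have "norm (F (Suc k) - G) < 2 * \<eta>"
    using norm_triangle_ineq[of "F (Suc k) - L" "L - G"] kL(1) G(1) by simp
  then have "norm (F (Suc k) - G) * K < 2 * \<eta> * K" using K(1) by simp
  then have "norm (\<Delta> i) < \<epsilon>" for i
    unfolding \<Delta>_def using K(2)[of "F (Suc k) - G"] \<eta>(2) by linarith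
  moreover have "perturbed_F A (sshp2 A X0) k 1 \<Delta> (k + 1 + 1) = 0"
  proof -
    \<comment> \<open>With \<open>k0 = k\<close> and \<open>m = 1\<close>, the iterate at index
      \<open>k + 1\<close> is the original one and is perturbed there. The index
      \<open>k + 2\<close> lies past the perturbed range, so the residual there is
      \<open>sshp2_map G\<close>.\<close>
    have "residual A (sshp2 A X0 (Suc k) + \<Delta> 1) = G"
      by (simp add: residual_add \<Delta>_def matrix_mul_assoc A' F_def sshp2_F_def)
    then show ?thesis
      using G(2) by (simp add: perturbed_F_def perturb_at_def residual_step)
  qed
  ultimately show "\<exists>k0 m \<Delta>. m > 0 \<and> (\<forall>i\<in>{1..m}. norm (\<Delta> i) < \<epsilon>) \<and>
      perturbed_F A (sshp2 A X0) k0 m \<Delta> (k0 + m + 1) = 0"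
    using zero_less_one by blast
qed

end
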